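(* For any constant $c$ with $5/3\leq c\leq 2$ and any $m\ge2$, the algorithm ALG($c$) described in the context is $c$-competitive: for every job sequence $\sigma$, the makespan of its final schedule is at most $c\cdot\mathrm{OPT}(\sigma)$.
   Context: Problem: jobs $J_1,\dots,J_n$ with processing times $p_i>0$ arrive online and must be assigned non-preemptively and immediately to one of $m$ identical machines $M_1,\dots,M_m$; a migration removes an assigned job and reassigns it. Makespan = maximum machine load in the final schedule; $\mathrm{OPT}(\sigma)$ = optimum offline makespan. Notation: $p_t^+=\sum_{i\le t}p_i$; $p_t^i$ = $i$-th largest processing time among $J_1,\dots,J_t$ ($0$ if $i>t$). $L_t=\max\{p_t^+/m,\ p_t^1,\ 2p_t^{m+1}\}$. Job $J_i$, $i\le t$, is small at time $t$ if $p_i\le(2c-3)L_t$; $J_t$ is small if small at time $t$, large otherwise. $\ell(j,t)$ = load of $M_j$ just before $J_t$ is assigned; $\ell_s(j,t)$ = same load counting only jobs small at time $t$. Machine sets: $A=\{M_1,\dots,M_{\lfloor m/2\rfloor}\}$, $B=\{M_{\lfloor m/2\rfloor+1},\dots,M_m\}$. Algorithm ALG($c$). Arrival phase: if $J_t$ is small, let $A'=\{M_j\in A:\ell_s(j,t)\le(c-1)L_t\}$; if $A'\ne\emptyset$ assign $J_t$ to a machine of $A'$ with smallest $\ell_s(j,t)$, otherwise to a least loaded machine of $B$. If $J_t$ is large: if some $M_j\in A$ has $\ell(j,t)\le(3-c)L_t$, assign $J_t$ to a least loaded machine of $A$, otherwise to a least loaded machine of $B$. Let $L=L_n$. Migration phase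 (after all jobs arrived; $\ell(j)$ = current load): removal: $R=\emptyset$; from every machine of $B$ remove its largest job and add it to $R$; while some $M_j\in A$ has $\ell(j)>(c-1)L$, remove its largest job and add it to $R$. Reassignment: sort $R$ by non-increasing processing time; for each job $J$ in this order, if some $M_j\in B$ has $\ell(j)+p(J)\le cL$ assign $J$ to such a machine, otherwise assign $J$ to a least loaded machine of $A$. *)

theory Defs
  imports Complex_Main
begin

text \<open>
  Jobs and machines are numbered from 1. The job sequence is given by \<open>p 1, \<dots>, p n\<close>; values of \<open>p\<close>
  outside \<open>{1..n}\<close> are never used. A (partial) schedule is a finite map from jobs to machines; jobs
  that are not (or currently not) assigned are mapped to \<^term>\<open>None\<close>.
\<close>

type_synonym schedule = "nat \<Rightarrow> nat option"

definition load :: "(nat \<Rightarrow> real) \<Rightarrow> schedule \<Rightarrow> nat \<Rightarrow> real" where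
  "load p s j = (\<Sum>i | s i = Some j. p i)"

definition makespan :: "nat \<Rightarrow> (nat \<Rightarrow> real) \<Rightarrow> schedule \<Rightarrow> real" where
  "makespan m p s = Max (load p s ` {1..m})"

definition schedules :: "nat \<Rightarrow> nat \<Rightarrow> schedule set" where
  "schedules m n = {s. dom s = {1..n} \<and> ran s \<subseteq> {1..m}}"

definition opt :: "nat \<Rightarrow> (nat \<Rightarrow> real) \<Rightarrow> nat \<Rightarrow> real" where
  "opt m p n = Min (makespan m p ` schedules m n)"

definition psum :: "(nat \<Rightarrow> real) \<Rightarrow> nat \<Rightarrow> real" where
  "psum p t = (\<Sum>i = 1..t. p i)"

text \<open>The \<open>k\<close>-th largest of \<open>p 1, \<dots>, p t\<close>, counted with multiplicity, for \<open>k \<ge> 1\<close>.\<close>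

definition kth_largest :: "(nat \<Rightarrow> real) \<Rightarrow> nat \<Rightarrow> nat \<Rightarrow> real" where
  "kth_largest p t k = (if k \<le> t then rev (sort (map p [1..<Suc t])) ! (k - 1) else 0)"

definition lower_bound :: "nat \<Rightarrow> (nat \<Rightarrow> real) \<Rightarrow> nat \<Rightarrow> real" where
  "lower_bound m p t =
     Max {psum p t / real m, kth_largest p t 1, 2 * kth_largest p t (m + 1)}"

definition small :: "real \<Rightarrow> nat \<Rightarrow> (nat \<Rightarrow> real) \<Rightarrow> nat \<Rightarrow> nat \<Rightarrow> bool" where
  "small c m p t i \<longleftrightarrow> p i \<le> (2 * c - 3) * lower_bound m p t"

definition small_load ::
    "real \<Rightarrow> nat \<Rightarrow> (nat \<Rightarrow> real) \<Rightarrow> nat \<Rightarrow> schedule \<Rightarrow> nat \<Rightarrow> real" where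
  "small_load c m p t s j = (\<Sum>i | s i = Some j \<and> small c m p t i. p i)"

definition machines_A :: "nat \<Rightarrow> nat set" where
  "machines_A m = {1..m div 2}"

definition machines_B :: "nat \<Rightarrow> nat set" where
  "machines_B m = {m div 2 + 1..m}"

text \<open>
  The algorithm leaves open how ties are broken and in which order machines are treated. It is
  therefore modelled as a relation, so that every way of resolving these choices is covered.
\<close>

text \<open>\<open>arrival_choice c m p t s j\<close>: job \<open>t\<close>, arriving when the current schedule is \<open>s\<close>, may be
  assigned to machine \<open>j\<close>.\<close>

definition arrival_choice ::
    "real \<Rightarrow> nat \<Rightarrow> (nat \<Rightarrow> real) \<Rightarrow> nat \<Rightarrow> schedule \<Rightarrow> nat \<Rightarrow> bool" where
  "arrival_choice c m p t s j \<longleftrightarrow>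
     (if small c m p t t then
        (let A' = {k \<in> machines_A m. small_load c m p t s k \<le> (c - 1) * lower_bound m p t} in
         if A' \<noteq> {} then is_arg_min (small_load c m p t s) (\<lambda>k. k \<in> A') j
         else is_arg_min (load p s) (\<lambda>k. k \<in> machines_B m) j)
      else
        (if \<exists>k \<in> machines_A m. load p s k \<le> (3 - c) * lower_bound m p t
         then is_arg_min (load p s) (\<lambda>k. k \<in> machines_A m) j
         else is_arg_min (load p s) (\<lambda>k. k \<in> machines_B m) j))"

inductive arrival_phase :: "real \<Rightarrow> nat \<Rightarrow> (nat \<Rightarrow> real) \<Rightarrow> nat \<Rightarrow> schedule \<Rightarrow> bool"
  for c m p where
  start: "arrival_phase c m p 0 Map.empty"
| arrive: "arrival_phase c m p t s \<Longrightarrow> arrival_choice c m p (Suc t) s j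
    \<Longrightarrow> arrival_phase c m p (Suc t) (s(Suc t \<mapsto> j))"

definition largest_job :: "(nat \<Rightarrow> real) \<Rightarrow> schedule \<Rightarrow> nat \<Rightarrow> nat \<Rightarrow> bool" where
  "largest_job p s j i \<longleftrightarrow> is_arg_max p (\<lambda>k. s k = Some j) i"

text \<open>
  Intermediate states of the removal consist of the schedule of the remaining jobs and the set
  \<open>R\<close> of removed jobs. Nothing is removed from an empty machine of \<open>B\<close>.
\<close>

definition removal_B :: "nat \<Rightarrow> (nat \<Rightarrow> real) \<Rightarrow> schedule \<Rightarrow> schedule \<Rightarrow> nat set \<Rightarrow> bool" where
  "removal_B m p s s' R \<longleftrightarrow>
     (\<exists>g. (\<forall>j \<in> machines_B m \<inter> ran s. largest_job p s j (g j)) \<and>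
          R = g ` (machines_B m \<inter> ran s) \<and> s' = s |` (- R))"

text \<open>In the following, \<open>L\<close> is the lower bound after the last arrival.\<close>

inductive removal_A ::
    "real \<Rightarrow> nat \<Rightarrow> (nat \<Rightarrow> real) \<Rightarrow> real \<Rightarrow> schedule \<Rightarrow> nat set \<Rightarrow> schedule \<Rightarrow> nat set \<Rightarrow> bool"
  for c m p L where
  stop: "\<forall>j \<in> machines_A m. load p s j \<le> (c - 1) * L \<Longrightarrow> removal_A c m p L s R s R"
| remove: "j \<in> machines_A m \<Longrightarrow> load p s j > (c - 1) * L \<Longrightarrow> largest_job p s j i
    \<Longrightarrow> removal_A c m p L (s(i := None)) (insert i R) s' R'
    \<Longrightarrow> removal_A c m p L s R s' R'"

inductive reassignment ::
    "real \<Rightarrow> nat \<Rightarrow> (nat \<Rightarrow> real) \<Rightarrow> real \<Rightarrow> nat list \<Rightarrow> schedule \<Rightarrow> schedule \<Rightarrow> bool"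
  for c m p L where
  finished: "reassignment c m p L [] s s"
| to_B: "j \<in> machines_B m \<Longrightarrow> load p s j + p i \<le> c * L
    \<Longrightarrow> reassignment c m p L is (s(i \<mapsto> j)) s' \<Longrightarrow> reassignment c m p L (i # is) s s'"
| to_A: "\<not> (\<exists>k \<in> machines_B m. load p s k + p i \<le> c * L)
    \<Longrightarrow> is_arg_min (load p s) (\<lambda>k. k \<in> machines_A m) j
    \<Longrightarrow> reassignment c m p L is (s(i \<mapsto> j)) s' \<Longrightarrow> reassignment c m p L (i # is) s s'"

text \<open>\<open>ALG c m p n s\<close>: on the job sequence \<open>p 1, \<dots>, p n\<close>, the algorithm may end with schedule \<open>s\<close>.\<close>

definition ALG :: "real \<Rightarrow> nat \<Rightarrow> (nat \<Rightarrow> real) \<Rightarrow> nat \<Rightarrow> schedule \<Rightarrow> bool" where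
  "ALG c m p n s \<longleftrightarrow>
     (\<exists>s0 s1 R1 s2 R2 is.
        arrival_phase c m p n s0 \<and>
        removal_B m p s0 s1 R1 \<and>
        removal_A c m p (lower_bound m p n) s1 R1 s2 R2 \<and>
        distinct is \<and> set is = R2 \<and> sorted_wrt (\<lambda>i k. p i \<ge> p k) is \<and>
        reassignment c m p (lower_bound m p n) is s2 s)"

text \<open>The relation \<^term>\<open>ALG\<close> is not vacuous: some final schedule always exists, and every final
  schedule is a complete schedule of the jobs.\<close>

lemma machines_finite [simp]: "finite (machines_A m)" "finite (machines_B m)"
  by (auto simp: machines_A_def machines_B_def)

lemma machines_nonempty: "2 \<le> m \<Longrightarrow> machines_A m \<noteq> {}" "2 \<le> m \<Longrightarrow> machines_B m \<noteq> {}"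
  by (auto simp: machines_A_def machines_B_def)

lemma machines_subset: "machines_A m \<subseteq> {1..m}" "machines_B m \<subseteq> {1..m}"
  by (auto simp: machines_A_def machines_B_def)

lemma ex_is_arg_min_on:
  fixes f :: "nat \<Rightarrow> real"
  assumes "finite M" "M \<noteq> {}"
  shows "\<exists>j. is_arg_min f (\<lambda>k. k \<in> M) j"
  using ex_is_arg_min_if_finite[OF assms, of f] by simp

lemma ex_largest_job:
  assumes "finite (dom s)" "j \<in> ran s"
  shows "\<exists>i. largest_job p s j i"
proof -
  let ?S = "{k. s k = Some j}"
  have "finite ?S" by (rule finite_subset[OF _ assms(1)]) auto
  moreover have "?S \<noteq> {}" using assms(2) by (auto simp: ran_def)
  ultimately have "\<exists>i. is_arg_min (\<lambda>k. - p k) (\<lambda>k. k \<in> ?S) i" by (rule ex_is_arg_min_on)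
  then show ?thesis by (auto simp: largest_job_def is_arg_min_def is_arg_max_def)
qed

lemma lower_bound_nonneg:
  assumes "\<And>i. i \<in> {1..n} \<Longrightarrow> 0 < p i"
  shows "0 \<le> lower_bound m p n"
proof -
  have "0 \<le> psum p n / real m"
    unfolding psum_def
    by (intro divide_nonneg_nonneg sum_nonneg of_nat_0_le_iff less_imp_le assms)
  also have "\<dots> \<le> lower_bound m p n" unfolding lower_bound_def by (rule Max_ge) auto
  finally show ?thesis .
qed

lemma arrival_choice_machine:
  "arrival_choice c m p t s j \<Longrightarrow> j \<in> {1..m}"
  using machines_subset[of m]
  by (auto simp: arrival_choice_def is_arg_min_def Let_def split: if_splits)

lemma ex_arrival_choice:
  assumes "2 \<le> m" shows "\<exists>j. arrival_choice c m p t s j"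
proof -
  let ?A' = "{k \<in> machines_A m. small_load c m p t s k \<le> (c - 1) * lower_bound m p t}"
  have "?A' \<noteq> {} \<Longrightarrow> \<exists>j. is_arg_min (small_load c m p t s) (\<lambda>k. k \<in> ?A') j"
    by (rule ex_is_arg_min_on) auto
  moreover have "\<exists>j. is_arg_min (load p s) (\<lambda>k. k \<in> machines_A m) j"
    "\<exists>j. is_arg_min (load p s) (\<lambda>k. k \<in> machines_B m) j"
    using machines_nonempty[OF assms] by (auto intro: ex_is_arg_min_on)
  ultimately show ?thesis
    unfolding arrival_choice_def Let_def
    by (cases "small c m p t t"; cases "?A' = {}";
        cases "\<exists>k \<in> machines_A m. load p s k \<le> (3 - c) * lower_bound m p t")
       (simp_all only: if_True if_False not_True_eq_False not_False_eq_True refl)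
qed

lemma arrival_phase_exists: "2 \<le> m \<Longrightarrow> \<exists>s. arrival_phase c m p t s"
  by (induction t) (use ex_arrival_choice in \<open>blast intro: arrival_phase.intros\<close>)+

lemma arrival_phase_schedules: "arrival_phase c m p t s \<Longrightarrow> s \<in> schedules m t"
proof (induction rule: arrival_phase.induct)
  case (arrive t s j)
  have "j \<in> {1..m}" by (rule arrival_choice_machine[OF arrive(2)])
  with arrive.IH have "ran (s(Suc t \<mapsto> j)) \<subseteq> {1..m}"
    unfolding schedules_def ran_def by (auto split: if_splits)
  moreover have "dom (s(Suc t \<mapsto> j)) = {1..Suc t}"
    using arrive.IH by (auto simp: schedules_def)
  ultimately show ?case unfolding schedules_def by blast
qed (auto simp: schedules_def)

lemma removal_B_exists:
  assumes "finite (dom s)" shows "\<exists>s' R. removal_B m p s s' R"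
proof -
  have "\<forall>j \<in> machines_B m \<inter> ran s. \<exists>i. largest_job p s j i"
    using ex_largest_job[OF assms] by blast
  then obtain g where "\<forall>j \<in> machines_B m \<inter> ran s. largest_job p s j (g j)" by metis
  then show ?thesis unfolding removal_B_def by blast
qed

lemma removal_B_jobs:
  assumes "removal_B m p s s' R"
  shows "dom s' \<union> R = dom s" "ran s' \<subseteq> ran s" "finite R"
  using assms
  by (auto simp: removal_B_def largest_job_def is_arg_max_def restrict_map_def ran_def
      split: if_splits)

lemma removal_A_exists:
  assumes "finite (dom s)" "0 \<le> (c - 1) * L"
  shows "\<exists>s' R'. removal_A c m p L s R s' R'"
  using assms(1)
proof (induction "card (dom s)" arbitrary: s R rule: less_induct)
  case less
  show ?case
  proof (cases "\<forall>j \<in> machines_A m. load p s j \<le> (c - 1) * L")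
    case False
    then obtain j where j: "j \<in> machines_A m" "load p s j > (c - 1) * L" by force
    then have "load p s j \<noteq> 0" using assms(2) by linarith
    then have "j \<in> ran s" by (auto simp: load_def ran_def intro!: sum.neutral)
    then obtain i where i: "largest_job p s j i" using ex_largest_job less.prems by blast
    then have "i \<in> dom s" by (auto simp: largest_job_def is_arg_max_def)
    then have "card (dom (s(i := None))) < card (dom s)"
      using less.prems by (intro psubset_card_mono) auto
    then have "\<exists>s' R'. removal_A c m p L (s(i := None)) (insert i R) s' R'"
      using less by auto
    then show ?thesis using removal_A.remove[OF j i] by blast
  qed (blast intro: removal_A.stop)
qed

lemma removal_A_jobs:
  "removal_A c m p L s R s' R' \<Longrightarrow>
    dom s' \<union> R' = dom s \<union> R \<and> ran s' \<subseteq> ran s \<and> (finite R \<longrightarrow> finite R')"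
proof (induction rule: removal_A.induct)
  case (remove j s i R s' R')
  then have "i \<in> dom s" by (auto simp: largest_job_def is_arg_max_def)
  moreover have "ran (s(i := None)) \<subseteq> ran s" by (auto simp: ran_def)
  moreover have "dom (s(i := None)) = dom s - {i}" by simp
  ultimately show ?case using remove.IH by blast
qed auto

lemma reassignment_exists:
  assumes "2 \<le> m" shows "\<exists>s'. reassignment c m p L is s s'"
proof (induction "is" arbitrary: s)
  case (Cons i "is")
  show ?case
  proof (cases "\<exists>k \<in> machines_B m. load p s k + p i \<le> c * L")
    case True
    then show ?thesis using Cons.IH by (blast intro: reassignment.to_B)
  next
    case False
    obtain j where "is_arg_min (load p s) (\<lambda>k. k \<in> machines_A m) j"
      using ex_is_arg_min_on machines_nonempty[OF assms] by (meson machines_finite)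
    then show ?thesis using Cons.IH False by (blast intro: reassignment.to_A)
  qed
qed (blast intro: reassignment.finished)

lemma reassignment_jobs:
  "reassignment c m p L is s s' \<Longrightarrow> ran s \<subseteq> {1..m} \<Longrightarrow>
    dom s' = dom s \<union> set is \<and> ran s' \<subseteq> {1..m}"
proof (induction rule: reassignment.induct)
  case (to_B j s i "is" s')
  have "ran (s(i \<mapsto> j)) \<subseteq> {1..m}"
    using to_B(1) to_B.prems machines_subset[of m] by (auto simp: ran_def)
  with to_B.IH have "dom s' = dom (s(i \<mapsto> j)) \<union> set is" "ran s' \<subseteq> {1..m}" by blast+
  then show ?case by (simp add: insert_commute)
next
  case (to_A s i j "is" s')
  have "ran (s(i \<mapsto> j)) \<subseteq> {1..m}"
    using to_A(2) to_A.prems machines_subset[of m] by (auto simp: ran_def is_arg_min_def)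
  with to_A.IH have "dom s' = dom (s(i \<mapsto> j)) \<union> set is" "ran s' \<subseteq> {1..m}" by blast+
  then show ?case by (simp add: insert_commute)
qed auto

lemma ALG_exists:
  assumes "1 \<le> c" "2 \<le> m" "\<And>i. i \<in> {1..n} \<Longrightarrow> 0 < p i"
  shows "\<exists>s. ALG c m p n s"
proof -
  obtain s0 where s0: "arrival_phase c m p n s0" using arrival_phase_exists assms by blast
  then have fin0: "finite (dom s0)" using arrival_phase_schedules by (fastforce simp: schedules_def)
  then obtain s1 R1 where s1: "removal_B m p s0 s1 R1" using removal_B_exists by blast
  have fin1: "finite (dom s1)" using removal_B_jobs(1)[OF s1] fin0 by (metis finite_Un)
  have "0 \<le> (c - 1) * lower_bound m p n" using lower_bound_nonneg assms by simp
  then obtain s2 R2 where s2: "removal_A c m p (lower_bound m p n) s1 R1 s2 R2"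
    using removal_A_exists[OF fin1] by blast
  have "finite R2" using removal_A_jobs[OF s2] removal_B_jobs(3)[OF s1] by blast
  define xs where "xs = rev (sort_key p (sorted_list_of_set R2))"
  have "sorted_wrt (\<lambda>i k. p i \<ge> p k) xs"
    using sorted_sort_key[of p "sorted_list_of_set R2"]
    by (simp add: xs_def sorted_wrt_rev sorted_wrt_map)
  moreover have "distinct xs" "set xs = R2" using \<open>finite R2\<close> by (auto simp: xs_def)
  moreover obtain s where "reassignment c m p (lower_bound m p n) xs s2 s"
    using reassignment_exists assms by blast
  ultimately show ?thesis using s0 s1 s2 unfolding ALG_def by blast
qed

lemma ALG_schedules: "ALG c m p n s \<Longrightarrow> s \<in> schedules m n"
  unfolding ALG_def
proof (elim exE conjE)
  fix s0 s1 R1 s2 R2 "is"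
  assume s0: "arrival_phase c m p n s0" and s1: "removal_B m p s0 s1 R1"
    and s2: "removal_A c m p (lower_bound m p n) s1 R1 s2 R2" and "set is = R2"
    and s: "reassignment c m p (lower_bound m p n) is s2 s"
  have "ran s2 \<subseteq> {1..m}"
    using arrival_phase_schedules[OF s0] removal_B_jobs[OF s1] removal_A_jobs[OF s2]
    by (auto simp: schedules_def)
  with reassignment_jobs[OF s] removal_A_jobs[OF s2] removal_B_jobs[OF s1]
    arrival_phase_schedules[OF s0] \<open>set is = R2\<close>
  show "s \<in> schedules m n" by (simp add: schedules_def)
qed

end

theory Submission imports Defs
begin

text \<open>
  \<open>L = L\<^sub>n\<close> is a lower bound on the optimum, so it suffices to keep all loads at most \<open>c L\<close>. Suppose
  this fails when a removed job \<open>J\<close> of length \<open>q\<close> is reassigned. Then every machine has load above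
  \<open>c L - q\<close>. If \<open>q \<le> L / 2\<close>, the total load exceeds \<open>m L\<close>. Otherwise, every machine of \<open>A\<close> has received
  a reassigned job of length at least \<open>q\<close>. If so has every machine of \<open>B\<close>, then together with \<open>J\<close>
  there are \<open>m + 1\<close> jobs longer than \<open>L / 2\<close>, contradicting \<open>L \<ge> 2 p\<^sub>n\<^sup>m\<^sup>+\<^sup>1\<close>. If not, some machine of \<open>B\<close> has
  load above \<open>(c - 1) L\<close> after the removal. By an averaging argument its last job was small at its
  arrival time \<open>t\<close>, where \<open>(3 - c) L\<^sub>t > (c - 1) L\<close>. All machines of \<open>A\<close> then carried small jobs of
  total length above \<open>(c - 1) L\<^sub>t \<ge> (2 - c) L\<close>; here \<open>c \<ge> 5/3\<close> is used. The removal leaves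
  load at least \<open>(2 - c) L\<close> there, so a machine of \<open>A\<close> and one of \<open>B\<close> together carry more than
  \<open>(2 - c) L + q + c L - q = 2 L\<close>, which again exceeds the total load.
\<close>

subsection \<open>The lower bound\<close>

text \<open>In a descending list the entries that are at least \<open>x\<close> form a prefix, so
  position \<open>k\<close>, counted from 0, belongs to it exactly when the prefix has more than
  \<open>k\<close> entries.\<close>

lemma le_nth_sorted_desc_iff:
  fixes x :: real
  assumes "sorted_wrt (\<ge>) xs" "k < length xs"
  shows "x \<le> xs ! k \<longleftrightarrow> k < length (filter ((\<le>) x) xs)"
  using assms
proof (induction xs arbitrary: k)
  case (Cons y ys)
  show ?case
  proof (cases "x \<le> y")
    case True
    then show ?thesis using Cons by (cases k) auto
  next
    case False
    then have "\<forall>z \<in> set (y # ys). \<not> x \<le> z" using Cons.prems by force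
    moreover from this have "filter ((\<le>) x) (y # ys) = []" by (metis filter_False)
    ultimately show ?thesis using nth_mem[OF Cons.prems(2)] by fastforce
  qed
qed simp

text \<open>Turns ranks into counts of jobs, the form that suits pigeonhole and monotonicity
  arguments. Positivity of \<open>x\<close> handles the default value: for \<open>k > t\<close> the
  left side fails because \<open>kth_largest\<close> is 0, the right side because there are only
  \<open>t\<close> jobs.\<close>

lemma le_kth_largest_iff:
  assumes "1 \<le> k" "0 < x"
  shows "x \<le> kth_largest p t k \<longleftrightarrow> k \<le> card {i \<in> {1..t}. x \<le> p i}"
proof -
  let ?xs = "rev (sort (map p [1..<Suc t]))"
  have "length (filter ((\<le>) x) ?xs) = length (filter ((\<le>) x) (map p [1..<Suc t]))"
    by (simp add: rev_filter[symmetric] filter_sort del: upt_Suc)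
  also have "\<dots> = card {i \<in> {1..t}. x \<le> p i}"
  proof -
    have "length (filter ((\<le>) x) (map p [1..<Suc t])) = length (filter (\<lambda>i. x \<le> p i) [1..<Suc t])"
      by (simp add: filter_map o_def)
    also have "\<dots> = card (set (filter (\<lambda>i. x \<le> p i) [1..<Suc t]))"
      by (rule distinct_card[symmetric]) simp
    also have "set (filter (\<lambda>i. x \<le> p i) [1..<Suc t]) = {i \<in> {1..t}. x \<le> p i}" by auto
    finally show ?thesis .
  qed
  finally have len: "length (filter ((\<le>) x) ?xs) = card {i \<in> {1..t}. x \<le> p i}" .
  show ?thesis
  proof (cases "k \<le> t")
    case True
    have "sorted_wrt (\<ge>) ?xs" by (simp add: sorted_wrt_rev)
    moreover have "k - 1 < length ?xs" using True assms by simp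
    ultimately have "x \<le> ?xs ! (k - 1) \<longleftrightarrow> k - 1 < length (filter ((\<le>) x) ?xs)"
      by (rule le_nth_sorted_desc_iff)
    then show ?thesis using True assms len by (auto simp: kth_largest_def)
  next
    case False
    have "card {i \<in> {1..t}. x \<le> p i} \<le> card {1..t}" by (rule card_mono) auto
    then show ?thesis using False assms by (simp add: kth_largest_def)
  qed
qed

lemma kth_largest_nonneg:
  assumes "1 \<le> k" "\<And>i. i \<in> {1..t} \<Longrightarrow> 0 < p i"
  shows "0 \<le> kth_largest p t k"
proof (cases "k \<le> t")
  case True
  let ?xs = "rev (sort (map p [1..<Suc t]))"
  have "?xs ! (k - 1) \<in> set ?xs" using True assms(1) by (intro nth_mem) simp
  then have "?xs ! (k - 1) \<in> p ` {1..t}" by auto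
  then show ?thesis using True assms(2) by (auto simp: kth_largest_def intro: less_imp_le)
qed (simp add: kth_largest_def)

text \<open>Take the earlier value itself as threshold: later arrivals can only increase the number
  of jobs that reach it. The counting criterion needs a positive threshold, hence the case
  split.\<close>

lemma kth_largest_mono:
  assumes "1 \<le> k" "u \<le> t" "\<And>i. i \<in> {1..t} \<Longrightarrow> 0 < p i"
  shows "kth_largest p u k \<le> kth_largest p t k"
proof (cases "0 < kth_largest p u k")
  case True
  let ?x = "kth_largest p u k"
  have "k \<le> card {i \<in> {1..u}. ?x \<le> p i}" using le_kth_largest_iff[OF assms(1) True, of p u] by simp
  also have "\<dots> \<le> card {i \<in> {1..t}. ?x \<le> p i}" using assms(2) by (intro card_mono) auto
  finally show ?thesis using le_kth_largest_iff[OF assms(1) True] by blast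
next
  case False
  moreover have "0 \<le> kth_largest p t k" by (rule kth_largest_nonneg[OF assms(1,3)])
  ultimately show ?thesis by linarith
qed

lemma lower_bound_ge:
  shows "psum p t / real m \<le> lower_bound m p t"
    and "kth_largest p t 1 \<le> lower_bound m p t"
    and "2 * kth_largest p t (m + 1) \<le> lower_bound m p t"
  unfolding lower_bound_def by (rule Max_ge; simp)+

lemma psum_le_lower_bound:
  assumes "0 < m"
  shows "psum p t \<le> real m * lower_bound m p t"
  using lower_bound_ge(1)[of p t m] assms by (simp add: pos_divide_le_eq mult.commute)

lemma lower_bound_mono:
  assumes "u \<le> t" "\<And>i. i \<in> {1..t} \<Longrightarrow> 0 < p i"
  shows "lower_bound m p u \<le> lower_bound m p t"
proof -
  have "psum p u \<le> psum p t" unfolding psum_def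
    using assms by (intro sum_mono2) (auto intro!: less_imp_le)
  then have "psum p u / real m \<le> psum p t / real m" by (rule divide_right_mono) simp
  moreover have "kth_largest p u 1 \<le> kth_largest p t 1"
    "kth_largest p u (m + 1) \<le> kth_largest p t (m + 1)"
    using assms by (auto intro!: kth_largest_mono)
  ultimately show ?thesis using lower_bound_ge[of p t m]
    unfolding lower_bound_def[of m p u] by (intro Max.boundedI) auto
qed

lemma job_le_lower_bound:
  assumes "i \<in> {1..t}" "0 < p i"
  shows "p i \<le> lower_bound m p t"
proof -
  have "card {i} \<le> card {k \<in> {1..t}. p i \<le> p k}" using assms(1) by (intro card_mono) auto
  then have "p i \<le> kth_largest p t 1" using le_kth_largest_iff[of 1 "p i" p t] assms by simp
  then show ?thesis using lower_bound_ge(2) order.trans by blast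
qed

subsection \<open>Loads\<close>

lemma finite_jobs: "finite (dom s) \<Longrightarrow> finite {i. s i = Some j \<and> P i}"
  by (rule finite_subset[of _ "dom s"]) auto

lemma load_upd:
  assumes "finite (dom s)" "i \<notin> dom s"
  shows "load p (s(i \<mapsto> j)) k = load p s k + (if k = j then p i else 0)"
proof (cases "k = j")
  case True
  have "{x. (s(i \<mapsto> j)) x = Some k} = insert i {x. s x = Some k}" using True by auto
  moreover have "i \<notin> {x. s x = Some k}" using assms(2) by auto
  moreover have "finite {x. s x = Some k}" using finite_jobs[OF assms(1), of k "\<lambda>_. True"] by simp
  ultimately show ?thesis using True by (simp add: load_def)
next
  case False
  then have "{x. (s(i \<mapsto> j)) x = Some k} = {x. s x = Some k}" using assms(2) by auto
  then show ?thesis using False by (simp add: load_def)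
qed

lemma load_remove:
  assumes "finite (dom s)" "s i = Some j"
  shows "load p (s(i := None)) k = load p s k - (if k = j then p i else 0)"
proof -
  have "s = (s(i := None))(i \<mapsto> j)" using assms(2) by auto
  moreover have "load p ((s(i := None))(i \<mapsto> j)) k = load p (s(i := None)) k + (if k = j then p i else 0)"
    by (rule load_upd) (use assms(1) in auto)
  ultimately show ?thesis by simp
qed

lemma sum_load:
  assumes "finite (dom s)" "ran s \<subseteq> {1..m}"
  shows "(\<Sum>j = 1..m. load p s j) = (\<Sum>i \<in> dom s. p i)"
proof -
  have "load p s j = (\<Sum>i \<in> {i \<in> dom s. the (s i) = j}. p i)" for j
    unfolding load_def by (rule sum.cong) auto
  moreover have "(\<lambda>i. the (s i)) ` dom s \<subseteq> {1..m}" using assms(2) by (auto simp: ran_def)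
  ultimately show ?thesis using sum.group[OF assms(1), of "{1..m}" "\<lambda>i. the (s i)" p] by simp
qed

lemma sum_machines:
  fixes f :: "nat \<Rightarrow> real"
  shows "(\<Sum>j = 1..m. f j) = (\<Sum>j \<in> machines_A m. f j) + (\<Sum>j \<in> machines_B m. f j)"
proof -
  have "{1..m} = machines_A m \<union> machines_B m" "machines_A m \<inter> machines_B m = {}"
    by (auto simp: machines_A_def machines_B_def)
  then show ?thesis by (simp add: sum.union_disjoint)
qed

lemma sum_jobs_mono:
  fixes p :: "nat \<Rightarrow> real"
  assumes "finite (dom s)" "\<And>i. i \<in> dom s \<Longrightarrow> 0 < p i" "I \<subseteq> J" "J \<subseteq> dom s"
  shows "(\<Sum>i \<in> I. p i) \<le> (\<Sum>i \<in> J. p i)"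
proof (rule sum_mono2)
  show "finite J" by (rule finite_subset[OF assms(4,1)])
  show "0 \<le> p b" if "b \<in> J - I" for b
  proof -
    have "b \<in> dom s" using that assms(4) by blast
    then show ?thesis using assms(2) less_imp_le by blast
  qed
qed (rule assms(3))

lemma load_mono:
  assumes "finite (dom s')" "s \<subseteq>\<^sub>m s'" "\<And>i. i \<in> dom s' \<Longrightarrow> 0 < p i"
  shows "load p s j \<le> load p s' j"
  unfolding load_def
proof (rule sum_jobs_mono[OF assms(1,3)])
  show "{i. s i = Some j} \<subseteq> {i. s' i = Some j}" using assms(2) by (force simp: map_le_def)
qed auto

text \<open>Serves two purposes: enlarging the schedule while the time of the smallness test is
  fixed, and moving that time forward while the schedule is fixed.\<close>

lemma small_load_mono:
  assumes "finite (dom s')" "s \<subseteq>\<^sub>m s'" "\<And>i. i \<in> dom s' \<Longrightarrow> 0 < p i"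
    and "\<And>i. small c m p t i \<Longrightarrow> small c m p t' i"
  shows "small_load c m p t s j \<le> small_load c m p t' s' j"
  unfolding small_load_def
proof (rule sum_jobs_mono[OF assms(1,3)])
  have "s' i = Some j" if "s i = Some j" for i using assms(2) that by (force simp: map_le_def)
  then show "{i. s i = Some j \<and> small c m p t i} \<subseteq> {i. s' i = Some j \<and> small c m p t' i}"
    using assms(4) by blast
qed auto

lemma small_load_le_load:
  assumes "finite (dom s)" "\<And>i. i \<in> dom s \<Longrightarrow> 0 < p i"
  shows "small_load c m p t s j \<le> load p s j"
  unfolding small_load_def load_def by (rule sum_jobs_mono[OF assms]) auto

lemma load_nonneg:
  assumes "\<And>i. i \<in> dom s \<Longrightarrow> 0 < p i"
  shows "0 \<le> load p s j"
  unfolding load_def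
proof (rule sum_nonneg)
  fix i assume "i \<in> {i. s i = Some j}"
  then have "i \<in> dom s" by auto
  then show "0 \<le> p i" using assms less_imp_le by blast
qed

lemma job_le_load:
  assumes "finite (dom s)" "\<And>i. i \<in> dom s \<Longrightarrow> 0 < p i" "s i = Some j"
  shows "p i \<le> load p s j"
proof -
  have "(\<Sum>k \<in> {i}. p k) \<le> load p s j"
    unfolding load_def by (rule sum_jobs_mono[OF assms(1,2)]) (use assms(3) in auto)
  then show ?thesis by simp
qed

section \<open>Comparison of the lower bound with the offline optimum\<close>

text \<open>The three terms are bounded by averaging over the machines, by the machine that carries
  the longest job, and by pigeonhole: two of the \<open>m + 1\<close> longest jobs share a
  machine.\<close>

lemma lower_bound_le_makespan:
  assumes s: "s \<in> schedules m n" and "0 < m" and pos: "\<And>i. i \<in> {1..n} \<Longrightarrow> 0 < p i"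
  shows "lower_bound m p n \<le> makespan m p s"
proof -
  let ?M = "makespan m p s"
  have dom: "dom s = {1..n}" and ran: "ran s \<subseteq> {1..m}" using s by (auto simp: schedules_def)
  have fin: "finite (dom s)" by (simp add: dom)
  have load: "load p s j \<le> ?M" if "j \<in> {1..m}" for j
    unfolding makespan_def using that by (intro Max_ge) auto
  have on: "\<exists>j \<in> {1..m}. s i = Some j" if "i \<in> {1..n}" for i
  proof -
    have "i \<in> dom s" using that by (simp only: dom)
    then obtain j where j: "s i = Some j" by (rule domD[THEN exE])
    show ?thesis by (rule bexI, rule j, rule subsetD[OF ran ranI[of s, OF j]])
  qed
  have job: "p i \<le> ?M" if i: "i \<in> {1..n}" for i
  proof -
    obtain j where j: "j \<in> {1..m}" "s i = Some j" using on[OF i] by blast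
    have "p i \<le> load p s j" by (rule job_le_load[OF fin _ j(2)]) (use dom pos in blast)
    then show ?thesis using load[OF j(1)] by simp
  qed
  have "psum p n = (\<Sum>j = 1..m. load p s j)"
    using sum_load[OF fin ran, of p] by (simp add: psum_def dom)
  also have "\<dots> \<le> (\<Sum>j = 1..m. ?M)" by (rule sum_mono) (rule load)
  finally have *: "psum p n / real m \<le> ?M"
    using \<open>0 < m\<close> by (simp add: pos_divide_le_eq mult.commute)
  have nonneg: "0 \<le> ?M"
  proof -
    have "0 \<le> load p s 1" by (rule load_nonneg) (use dom pos in blast)
    then show ?thesis using load[of 1] \<open>0 < m\<close> by simp
  qed
  have **: "kth_largest p n 1 \<le> ?M"
  proof (cases "0 < kth_largest p n 1")
    case True
    then have "1 \<le> card {i \<in> {1..n}. kth_largest p n 1 \<le> p i}"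
      using le_kth_largest_iff[of 1 "kth_largest p n 1" p n] by simp
    then have "{i \<in> {1..n}. kth_largest p n 1 \<le> p i} \<noteq> {}" by (metis card.empty not_one_le_zero)
    then show ?thesis using job by fastforce
  qed (use nonneg in linarith)
  have ***: "2 * kth_largest p n (m + 1) \<le> ?M"
  proof (cases "0 < kth_largest p n (m + 1)")
    case True
    let ?x = "kth_largest p n (m + 1)"
    let ?I = "{i \<in> {1..n}. ?x \<le> p i}"
    have card: "m + 1 \<le> card ?I" using le_kth_largest_iff[of "m + 1" ?x p n] True by simp
    have "the (s i) \<in> {1..m}" if "i \<in> ?I" for i using on[of i] that by auto
    then have "(\<lambda>i. the (s i)) ` ?I \<subseteq> {1..m}" by blast
    then have "card ((\<lambda>i. the (s i)) ` ?I) \<le> card {1..m}" by (intro card_mono) simp_all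
    then have "\<not> inj_on (\<lambda>i. the (s i)) ?I" using card by (intro pigeonhole) simp_all
    then obtain i k where ik: "i \<in> ?I" "k \<in> ?I" "i \<noteq> k" "the (s i) = the (s k)"
      by (auto simp: inj_on_def)
    obtain j where j: "j \<in> {1..m}" "s i = Some j" using on[of i] ik by auto
    have "s k = Some j" using on[of k] ik j by auto
    then have "(\<Sum>x \<in> {i, k}. p x) \<le> load p s j" unfolding load_def
      using j(2) by (intro sum_jobs_mono[OF fin]) (use dom pos in \<open>blast, auto\<close>)
    then show ?thesis using load[OF j(1)] ik by simp
  qed (use nonneg in linarith)
  show ?thesis unfolding lower_bound_def using * ** *** by (intro Max.boundedI) auto
qed

lemma lower_bound_le_opt:
  assumes "0 < m" and "\<And>i. i \<in> {1..n} \<Longrightarrow> 0 < p i" and "schedules m n \<noteq> {}"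
  shows "lower_bound m p n \<le> opt m p n"
proof -
  have "finite (schedules m n)" unfolding schedules_def
    by (rule finite_set_of_finite_maps) auto
  then show ?thesis unfolding opt_def
    using assms lower_bound_le_makespan by (intro Min.boundedI) auto
qed

subsection \<open>Arrival phase\<close>

text \<open>Stated over the reals to keep \<open>div\<close> and truncated subtraction out of the
  averaging arguments. For odd \<open>m\<close> the extra machine belongs to
  \<open>B\<close>.\<close>

lemma card_machines:
  shows "real (card (machines_B m)) = real m - real (card (machines_A m))"
    and "real m = 2 * real (card (machines_A m)) \<or> real m = 2 * real (card (machines_A m)) + 1"
proof -
  show "real (card (machines_B m)) = real m - real (card (machines_A m))"
    by (simp add: machines_A_def machines_B_def of_nat_diff)
  have "m = 2 * (m div 2) \<or> m = 2 * (m div 2) + 1" by linarith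
  then have "real m = real (2 * (m div 2)) \<or> real m = real (2 * (m div 2) + 1)" by presburger
  then show "real m = 2 * real (card (machines_A m)) \<or> real m = 2 * real (card (machines_A m)) + 1"
    by (simp add: machines_A_def add.commute)
qed

lemma card_mult_le_sum:
  fixes f :: "nat \<Rightarrow> real"
  assumes "\<And>j. j \<in> M \<Longrightarrow> x \<le> f j"
  shows "real (card M) * x \<le> (\<Sum>j \<in> M. f j)"
  using sum_bounded_below[of M x f] assms by simp

text \<open>Averaging at the arrival of job \<open>Suc t\<close>: every machine of \<open>B\<close>
  is at least as loaded as \<open>j\<close>, and all processing times up to this job sum to at most
  \<open>m\<close> times the lower bound. The new job is kept in the sum because its length matters
  when it is large.\<close>

lemma least_loaded_B:
  assumes s: "s \<in> schedules m t"
    and j: "is_arg_min (load p s) (\<lambda>k. k \<in> machines_B m) j"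
    and A: "\<And>k. k \<in> machines_A m \<Longrightarrow> x \<le> load p s k"
    and "0 < m"
  shows "real (card (machines_A m)) * x + real (card (machines_B m)) * load p s j + p (Suc t)
    \<le> real m * lower_bound m p (Suc t)"
proof -
  have dom: "dom s = {1..t}" and ran: "ran s \<subseteq> {1..m}" using s by (auto simp: schedules_def)
  have B: "load p s j \<le> load p s k" if "k \<in> machines_B m" for k
    using j that by (force simp: is_arg_min_def)
  have "real (card (machines_A m)) * x + real (card (machines_B m)) * load p s j
    \<le> (\<Sum>j = 1..m. load p s j)"
    unfolding sum_machines by (intro add_mono card_mult_le_sum A B)
  also have "\<dots> = psum p t" using sum_load[of s m p] dom ran by (simp add: psum_def)
  finally show ?thesis using psum_le_lower_bound[OF \<open>0 < m\<close>, of p "Suc t"]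
    by (simp add: psum_def)
qed

text \<open>
  The witness \<open>i\<close> is the last job assigned to \<open>j\<close> and \<open>u\<close> its arrival time; the two alternatives
  correspond to \<open>i\<close> being large and small, respectively.
\<close>

lemma arrival_phase_B:
  assumes "arrival_phase c m p t s"
    and c: "5 / 3 \<le> c" "c \<le> 2" and m: "2 \<le> m"
    and "\<And>i. i \<in> {1..t} \<Longrightarrow> 0 < p i"
    and "j \<in> machines_B m" "j \<in> ran s"
  shows "\<exists>i u. s i = Some j \<and> u \<le> t \<and>
    (load p s j - p i \<le> (c - 1) * lower_bound m p u \<or>
     load p s j - p i \<le> (3 - c) * lower_bound m p u \<and>
     (\<forall>k \<in> machines_A m. (c - 1) * lower_bound m p u \<le> small_load c m p u s k))"
  using assms(1,5-)
proof (induction arbitrary: j rule: arrival_phase.induct)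
  case start
  then show ?case by simp
next
  case (arrive t s j')
  let ?s = "s(Suc t \<mapsto> j')"
  let ?L = "lower_bound m p (Suc t)"
  let ?a = "real (card (machines_A m))"
  let ?b = "real (card (machines_B m))"
  have sched: "s \<in> schedules m t" by (rule arrival_phase_schedules[OF arrive(1)])
  then have dom: "dom s = {1..t}" by (simp add: schedules_def)
  then have fin: "finite (dom s)" by simp
  have new: "Suc t \<notin> dom s" using dom by simp
  have le: "s \<subseteq>\<^sub>m ?s" using new by (auto simp: map_le_def)
  have pos': "0 < p i" if "i \<in> dom s" for i using that arrive.prems(1) dom by auto
  have mono: "small_load c m p u s k \<le> small_load c m p u ?s k" for u k
    by (rule small_load_mono[OF _ le]) (use fin dom arrive.prems(1) in auto)
  show ?case
  proof (cases "j = j'")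
    \<comment> \<open>The job went to another machine. The old witness remains valid: the load of
      \<open>j\<close> is unchanged, and small loads measured at the fixed time \<open>u\<close>
      only grow.\<close>
    case False
    have "j \<in> ran s" using arrive.prems(3) False by (auto simp: ran_def split: if_splits)
    then obtain i u where iu: "s i = Some j" "u \<le> t"
      "load p s j - p i \<le> (c - 1) * lower_bound m p u \<or>
       load p s j - p i \<le> (3 - c) * lower_bound m p u \<and>
       (\<forall>k \<in> machines_A m. (c - 1) * lower_bound m p u \<le> small_load c m p u s k)"
      using arrive.IH[of j] arrive.prems by auto
    have "load p ?s j = load p s j" using load_upd[OF fin new] False by simp
    moreover have "?s i = Some j" using iu(1) new by auto
    moreover have "\<forall>k \<in> machines_A m. (c - 1) * lower_bound m p u \<le> small_load c m p u ?s k"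
      if "\<forall>k \<in> machines_A m. (c - 1) * lower_bound m p u \<le> small_load c m p u s k"
      using that mono order.trans by blast
    ultimately have "?s i = Some j \<and> u \<le> Suc t \<and>
      (load p ?s j - p i \<le> (c - 1) * lower_bound m p u \<or>
       load p ?s j - p i \<le> (3 - c) * lower_bound m p u \<and>
       (\<forall>k \<in> machines_A m. (c - 1) * lower_bound m p u \<le> small_load c m p u ?s k))"
      using iu by auto
    then show ?thesis by blast
  next
    case True
    have load: "load p ?s j - p (Suc t) = load p s j" using load_upd[OF fin new] True by simp
    have jA: "j \<notin> machines_A m" using arrive.prems(2) by (auto simp: machines_A_def machines_B_def)
    have L: "0 \<le> ?L" by (rule lower_bound_nonneg) (use arrive.prems(1) in auto)
    have b: "?b > 0" using machines_nonempty(2)[OF m] by (simp add: card_gt_0_iff)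
    have p: "0 < p (Suc t)" using arrive.prems(1) by simp
    have "load p s j \<le> (c - 1) * ?L \<or> load p s j \<le> (3 - c) * ?L \<and>
      (\<forall>k \<in> machines_A m. (c - 1) * ?L \<le> small_load c m p (Suc t) s k)"
    proof (cases "small c m p (Suc t) (Suc t)")
      case sm: True
      let ?A' = "{k \<in> machines_A m. small_load c m p (Suc t) s k \<le> (c - 1) * ?L}"
      \<comment> \<open>A small job reaches \<open>B\<close> only if every machine of
        \<open>A\<close> has exceeded its threshold for small jobs.\<close>
      have "?A' = {}"
      proof (rule ccontr)
        assume "?A' \<noteq> {}"
        then have "is_arg_min (small_load c m p (Suc t) s) (\<lambda>k. k \<in> ?A') j"
          using arrive(2) sm True by (simp add: arrival_choice_def Let_def)
        then show False using jA by (simp add: is_arg_min_def)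
      qed
      then have A: "(c - 1) * ?L \<le> small_load c m p (Suc t) s k" if "k \<in> machines_A m" for k
        using that by force
      have arg: "is_arg_min (load p s) (\<lambda>k. k \<in> machines_B m) j"
        using arrive(2) sm True \<open>?A' = {}\<close> by (simp add: arrival_choice_def Let_def)
      have "(c - 1) * ?L \<le> load p s k" if "k \<in> machines_A m" for k
        using A[OF that] small_load_le_load[OF fin, of p c m "Suc t" k] pos' by fastforce
      then have "?a * ((c - 1) * ?L) + ?b * load p s j + p (Suc t) \<le> real m * ?L"
        using m by (intro least_loaded_B[OF sched arg]) auto
      \<comment> \<open>Since \<open>m - 2 * ?a\<close> is 0 or 1, both sides agree for even
        \<open>m\<close> and differ by \<open>(2 - c) * ?L\<close> for odd \<open>m\<close>, which
        is nonnegative because \<open>c <= 2\<close>.\<close>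
      moreover have "real m * ?L - ?a * ((c - 1) * ?L) \<le> ?b * ((3 - c) * ?L)"
      proof -
        have "?b * ((3 - c) * ?L) - (real m * ?L - ?a * ((c - 1) * ?L)) = (real m - 2 * ?a) * (2 - c) * ?L"
          unfolding card_machines(1) by (simp add: algebra_simps)
        moreover have "0 \<le> (real m - 2 * ?a) * (2 - c) * ?L"
          using card_machines(2)[of m] c L by (intro mult_nonneg_nonneg) auto
        ultimately show ?thesis by linarith
      qed
      ultimately have "?b * load p s j \<le> ?b * ((3 - c) * ?L)" using p by linarith
      then show ?thesis using A b by simp
    next
      case lg: False
      have ex: "\<not> (\<exists>k \<in> machines_A m. load p s k \<le> (3 - c) * ?L)"
      proof
        assume "\<exists>k \<in> machines_A m. load p s k \<le> (3 - c) * ?L"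
        then have "is_arg_min (load p s) (\<lambda>k. k \<in> machines_A m) j"
          using arrive(2) lg True by (simp add: arrival_choice_def)
        then show False using jA by (simp add: is_arg_min_def)
      qed
      then have arg: "is_arg_min (load p s) (\<lambda>k. k \<in> machines_B m) j"
        using arrive(2) lg True by (simp add: arrival_choice_def)
      have "?a * ((3 - c) * ?L) + ?b * load p s j + p (Suc t) \<le> real m * ?L"
        using ex m by (intro least_loaded_B[OF sched arg]) force+
      moreover have "(2 * c - 3) * ?L < p (Suc t)" using lg by (simp add: small_def)
      \<comment> \<open>For odd \<open>m\<close> the length of the large job pays for the extra
        machine of \<open>B\<close>. This requires \<open>2 - c <= 2 * c - 3\<close>, that is,
        \<open>c >= 5/3\<close>.\<close>
      moreover have "real m * ?L - ?a * ((3 - c) * ?L) - (2 * c - 3) * ?L \<le> ?b * ((c - 1) * ?L)"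
      proof -
        have "?b * ((c - 1) * ?L) - (real m * ?L - ?a * ((3 - c) * ?L) - (2 * c - 3) * ?L)
          = ((2 * c - 3) - (real m - 2 * ?a) * (2 - c)) * ?L"
          unfolding card_machines(1) by (simp add: algebra_simps)
        moreover have "0 \<le> ((2 * c - 3) - (real m - 2 * ?a) * (2 - c)) * ?L"
          using card_machines(2)[of m] c L by (intro mult_nonneg_nonneg) auto
        ultimately show ?thesis by linarith
      qed
      ultimately have "?b * load p s j \<le> ?b * ((c - 1) * ?L)" by linarith
      then show ?thesis using b by simp
    qed
    moreover have "?s (Suc t) = Some j" using True by simp
    moreover have "\<forall>k \<in> machines_A m. (c - 1) * ?L \<le> small_load c m p (Suc t) ?s k"
      if "\<forall>k \<in> machines_A m. (c - 1) * ?L \<le> small_load c m p (Suc t) s k"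
      using that mono order.trans by blast
    ultimately show ?thesis using load by (metis order.refl)
  qed
qed

subsection \<open>Job removal\<close>

text \<open>The bound on \<open>B\<close> holds for an arbitrary job \<open>i\<close> on
  \<open>j\<close>, as the removed job is at least as long; hence the last job assigned to
  \<open>j\<close> may be used. For \<open>A\<close> the job sets are compared rather than the
  loads, so that small loads are covered too.\<close>

lemma removal_B_load:
  assumes "removal_B m p s s' R" and fin: "finite (dom s)"
  shows "j \<in> machines_A m \<Longrightarrow> {i. s' i = Some j} = {i. s i = Some j}"
    and "j \<in> machines_B m \<Longrightarrow> s i = Some j \<Longrightarrow> load p s' j \<le> load p s j - p i"
    and "j \<in> machines_B m \<Longrightarrow> j \<notin> ran s \<Longrightarrow> load p s' j = 0"
proof -
  obtain g where g: "\<forall>j \<in> machines_B m \<inter> ran s. largest_job p s j (g j)"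
    and R: "R = g ` (machines_B m \<inter> ran s)" and s': "s' = s |` (- R)"
    using assms(1) by (auto simp: removal_B_def)
  have gS: "s (g j) = Some j" if "j \<in> machines_B m \<inter> ran s" for j
    using g that by (auto simp: largest_job_def is_arg_max_def)
  show "{i. s' i = Some j} = {i. s i = Some j}" if "j \<in> machines_A m"
    using that gS unfolding s' R
    by (auto simp: restrict_map_def machines_A_def machines_B_def split: if_splits)
  show "load p s' j \<le> load p s j - p i" if j: "j \<in> machines_B m" and i: "s i = Some j"
  proof -
    have jr: "j \<in> machines_B m \<inter> ran s" using j i by (auto simp: ran_def)
    have "{k. s' k = Some j} = {k. s k = Some j} - {g j}"
      using gS jr unfolding s' R by (auto simp: restrict_map_def split: if_splits)
    moreover have "finite {k. s k = Some j}" using finite_jobs[OF fin, of j "\<lambda>_. True"] by simp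
    ultimately have "load p s' j = load p s j - p (g j)"
      using gS[OF jr] unfolding load_def by (simp add: sum_diff1)
    moreover have "p i \<le> p (g j)"
      using g jr i by (force simp: largest_job_def is_arg_max_def)
    ultimately show ?thesis by linarith
  qed
  show "load p s' j = 0" if "j \<in> machines_B m" "j \<notin> ran s"
    using that unfolding s' load_def
    by (intro sum.neutral) (auto simp: restrict_map_def ran_def split: if_splits)
qed

lemma removal_A_props:
  assumes "removal_A c m p L s R s' R'" and "finite (dom s)"
  shows "(\<forall>j \<in> machines_A m. load p s' j \<le> (c - 1) * L) \<and>
    (\<forall>j \<in> machines_B m. load p s' j = load p s j) \<and>
    (dom s \<inter> R = {} \<longrightarrow> dom s' \<inter> R' = {})"
  using assms
proof (induction rule: removal_A.induct)
  case (remove j s i R s' R')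
  have i: "s i = Some j" using remove(3) by (simp add: largest_job_def is_arg_max_def)
  have fin: "finite (dom (s(i := None)))" using remove.prems by simp
  have "load p (s(i := None)) k = load p s k" if "k \<in> machines_B m" for k
    using load_remove[of s i j p k] remove.prems i remove(1) that
    by (auto simp: machines_A_def machines_B_def)
  moreover have "dom (s(i := None)) \<inter> insert i R = {}" if "dom s \<inter> R = {}" using that by auto
  ultimately show ?case using remove.IH[OF fin] by metis
qed auto

text \<open>
  A job that is small at time \<open>n\<close> is only removed from a machine without large jobs, so its small
  load is then above \<open>(c - 1) L\<close> and drops by at most \<open>(2 c - 3) L\<close>.
\<close>

lemma removal_A_small_load:
  assumes "removal_A c m p (lower_bound m p n) s R s' R'" and "finite (dom s)"
    and "\<And>j. j \<in> machines_A m \<Longrightarrow> (2 - c) * lower_bound m p n \<le> small_load c m p n s j"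
    and "k \<in> machines_A m"
  shows "(2 - c) * lower_bound m p n \<le> small_load c m p n s' k"
  using assms
proof (induction rule: removal_A.induct)
  case (remove j s i R s' R')
  let ?L = "lower_bound m p n"
  have i: "s i = Some j" using remove(3) by (simp add: largest_job_def is_arg_max_def)
  have max: "p x \<le> p i" if "s x = Some j" for x
    using remove(3) that by (force simp: largest_job_def is_arg_max_def)
  have fin: "finite (dom (s(i := None)))" using remove.prems by simp
  have "(2 - c) * ?L \<le> small_load c m p n (s(i := None)) k" if k: "k \<in> machines_A m" for k
  proof (cases "k = j \<and> small c m p n i")
    case True
    then have sm: "p i \<le> (2 * c - 3) * ?L" by (simp add: small_def)
    then have "small_load c m p n (s(i := None)) k = load p (s(i := None)) k"
      unfolding small_load_def load_def using True max
      by (intro sum.cong) (fastforce simp: small_def split: if_splits)+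
    also have "\<dots> = load p s j - p i" using load_remove[of s i j p k] remove.prems(1) i True by simp
    also have "(2 - c) * ?L \<le> \<dots>" using remove(2) sm by (simp add: algebra_simps)
    finally show ?thesis .
  next
    case False
    \<comment> \<open>A large job, or one removed from another machine, does not contribute to the
      small load of \<open>k\<close>.\<close>
    then have "{x. (s(i := None)) x = Some k \<and> small c m p n x} = {x. s x = Some k \<and> small c m p n x}"
      using i by auto
    then show ?thesis using remove.prems(2)[OF k] by (simp add: small_load_def)
  qed
  then show ?case by (rule remove.IH[OF fin _ remove.prems(3)])
qed auto

text \<open>Removing a largest job lowers the load of \<open>j\<close> by at least the length of its
  last job. Both bounds from the arrival phase then suffice, as \<open>c - 1\<close> and
  \<open>3 - c\<close> are at most \<open>c\<close>.\<close>

lemma load_after_removal_B: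
  assumes s0: "arrival_phase c m p n s0" and s1: "removal_B m p s0 s1 R1"
    and c: "5 / 3 \<le> c" "c \<le> 2" and m: "2 \<le> m"
    and pos: "\<And>i. i \<in> {1..n} \<Longrightarrow> 0 < p i"
    and j: "j \<in> machines_B m"
  shows "load p s1 j \<le> c * lower_bound m p n"
proof -
  let ?L = "lower_bound m p n"
  have "dom s0 = {1..n}" using arrival_phase_schedules[OF s0] by (simp add: schedules_def)
  then have fin0: "finite (dom s0)" by simp
  have L: "0 \<le> ?L" by (rule lower_bound_nonneg) (rule pos)
  show ?thesis
  proof (cases "j \<in> ran s0")
    case False
    then show ?thesis using removal_B_load(3)[OF s1 fin0 j] L c by simp
  next
    case True
    obtain i u where i: "s0 i = Some j" and u: "u \<le> n" and
      iu: "load p s0 j - p i \<le> (c - 1) * lower_bound m p u \<or>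
       load p s0 j - p i \<le> (3 - c) * lower_bound m p u"
      using arrival_phase_B[OF s0 c m pos j True] by blast
    have LL: "lower_bound m p u \<le> ?L" by (rule lower_bound_mono[OF u pos])
    have "(c - 1) * lower_bound m p u \<le> (c - 1) * ?L" "(3 - c) * lower_bound m p u \<le> (3 - c) * ?L"
      using LL c by (auto intro!: mult_left_mono)
    moreover have "(c - 1) * ?L \<le> c * ?L" "(3 - c) * ?L \<le> c * ?L"
      using L c by (auto intro!: mult_right_mono)
    ultimately show ?thesis using removal_B_load(2)[OF s1 fin0 j i] iu by linarith
  qed
qed

text \<open>A machine of \<open>B\<close> that is still above \<open>(c - 1) * L\<close> must come
  from the second alternative of \<open>arrival_phase_B\<close>, and the small loads on
  \<open>A\<close> guaranteed there remain sufficient through both removals.\<close>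

lemma load_after_removal:
  assumes s0: "arrival_phase c m p n s0" and s1: "removal_B m p s0 s1 R1"
    and s2: "removal_A c m p (lower_bound m p n) s1 R1 s2 R2"
    and c: "5 / 3 \<le> c" "c \<le> 2" and m: "2 \<le> m"
    and pos: "\<And>i. i \<in> {1..n} \<Longrightarrow> 0 < p i"
  shows "(\<forall>j \<in> machines_B m. load p s2 j \<le> (c - 1) * lower_bound m p n) \<or>
    (\<forall>k \<in> machines_A m. (2 - c) * lower_bound m p n \<le> load p s2 k)"
proof (intro disjCI ballI)
  let ?L = "lower_bound m p n"
  assume "\<not> (\<forall>k \<in> machines_A m. (2 - c) * ?L \<le> load p s2 k)"
  then obtain k where k: "k \<in> machines_A m" "load p s2 k < (2 - c) * ?L" by force
  fix j assume j: "j \<in> machines_B m"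
  have dom0: "dom s0 = {1..n}" using arrival_phase_schedules[OF s0] by (simp add: schedules_def)
  have fin0: "finite (dom s0)" by (simp add: dom0)
  have fin1: "finite (dom s1)" using removal_B_jobs(1)[OF s1] fin0 by (metis finite_Un)
  have dom2: "dom s2 \<subseteq> {1..n}"
    using removal_A_jobs[OF s2] removal_B_jobs(1)[OF s1] dom0 by auto
  have fin2: "finite (dom s2)" by (rule finite_subset[OF dom2]) simp
  have L: "0 \<le> ?L" by (rule lower_bound_nonneg) (rule pos)
  have load: "load p s2 j = load p s1 j" using removal_A_props[OF s2 fin1] j by blast
  show "load p s2 j \<le> (c - 1) * ?L"
  proof (cases "j \<in> ran s0")
    case False
    have "load p s1 j = 0" by (rule removal_B_load(3)[OF s1 fin0 j False])
    then show ?thesis using load L c by simp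
  next
    case True
    obtain i u where i: "s0 i = Some j" and u: "u \<le> n" and
      iu: "load p s0 j - p i \<le> (c - 1) * lower_bound m p u \<or>
       load p s0 j - p i \<le> (3 - c) * lower_bound m p u \<and>
       (\<forall>k \<in> machines_A m. (c - 1) * lower_bound m p u \<le> small_load c m p u s0 k)"
      using arrival_phase_B[OF s0 c m pos j True] by blast
    let ?L' = "lower_bound m p u"
    have LL: "?L' \<le> ?L" by (rule lower_bound_mono[OF u pos])
    have le: "load p s2 j \<le> load p s0 j - p i" using removal_B_load(2)[OF s1 fin0 j i] load by simp
    show ?thesis
    proof (rule ccontr)
      assume "\<not> ?thesis"
      then have gt: "(c - 1) * ?L < load p s0 j - p i" using le by simp
      moreover have "(c - 1) * ?L' \<le> (c - 1) * ?L" using LL c by (intro mult_left_mono) auto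
      \<comment> \<open>This excludes the first alternative, whose bound would not exceed
        \<open>(c - 1) * ?L\<close>.\<close>
      ultimately have "\<not> load p s0 j - p i \<le> (c - 1) * ?L'" by linarith
      then have "load p s0 j - p i \<le> (3 - c) * ?L'"
        and 2: "\<forall>x \<in> machines_A m. (c - 1) * ?L' \<le> small_load c m p u s0 x" using iu by blast+
      then have 1: "(c - 1) * ?L < (3 - c) * ?L'" using gt by linarith
      have 3: "(2 - c) * ?L \<le> (c - 1) * ?L'"
      proof -
        \<comment> \<open>After expansion this inequality is exactly \<open>5 <= 3 * c\<close>.
          Combined with \<open>1\<close> it transfers the small-load bound from time
          \<open>u\<close> to time \<open>n\<close>.\<close>
        have "(2 - c) * (3 - c) \<le> (c - 1) * (c - 1)" using c by (simp add: algebra_simps)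
        then have "(2 - c) * (3 - c) * ?L \<le> (c - 1) * (c - 1) * ?L" by (rule mult_right_mono[OF _ L])
        also have "\<dots> = (c - 1) * ((c - 1) * ?L)" by simp
        also have "\<dots> \<le> (c - 1) * ((3 - c) * ?L')" using 1 c by (intro mult_left_mono) auto
        finally have "(3 - c) * ((2 - c) * ?L) \<le> (3 - c) * ((c - 1) * ?L')"
          by (simp add: mult.assoc mult.left_commute)
        then show ?thesis using c by simp
      qed
      \<comment> \<open>The smallness threshold grows with time, so no small job turns large and
        small loads at \<open>u\<close> bound those at \<open>n\<close> from below.\<close>
      have small: "small c m p n x" if "small c m p u x" for x
      proof -
        have "(2 * c - 3) * ?L' \<le> (2 * c - 3) * ?L" using LL c by (intro mult_left_mono) auto
        then show ?thesis using that by (simp add: small_def)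
      qed
      have "(2 - c) * ?L \<le> small_load c m p n s1 x" if x: "x \<in> machines_A m" for x
      proof -
        have "{y. s1 y = Some x \<and> small c m p n y} = {y. s0 y = Some x \<and> small c m p n y}"
          using removal_B_load(1)[OF s1 fin0 x] by blast
        then have "small_load c m p n s1 x = small_load c m p n s0 x" by (simp add: small_load_def)
        moreover have "small_load c m p u s0 x \<le> small_load c m p n s0 x"
          by (rule small_load_mono[OF fin0 _ _ small]) (use dom0 pos in auto)
        ultimately show ?thesis using bspec[OF 2 x] 3 by linarith
      qed
      then have "(2 - c) * ?L \<le> small_load c m p n s2 k"
        by (rule removal_A_small_load[OF s2 fin1 _ k(1)])
      also have "\<dots> \<le> load p s2 k"
        by (rule small_load_le_load[OF fin2]) (use dom2 pos in blast)
      finally show False using k(2) by simp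
    qed
  qed
qed

subsection \<open>Job reassignment\<close>

text \<open>Excludes the situation in which job \<open>i\<close> fits on no machine, so that
  resorting to a least loaded machine of \<open>A\<close> is safe. The hypothesis \<open>big\<close>
  reflects the non-increasing order of reassignment.\<close>

lemma reassignment_step:
  assumes c: "5 / 3 \<le> c" and m: "2 \<le> m"
    and pos: "\<And>i. i \<in> {1..n} \<Longrightarrow> 0 < p i"
    and A2: "\<And>j. j \<in> machines_A m \<Longrightarrow> load p s2 j \<le> (c - 1) * lower_bound m p n"
    and alt: "(\<forall>j \<in> machines_B m. load p s2 j \<le> (c - 1) * lower_bound m p n) \<or>
      (\<forall>k \<in> machines_A m. (2 - c) * lower_bound m p n \<le> load p s2 k)"
    and le: "s2 \<subseteq>\<^sub>m s" and dom: "dom s \<subseteq> {1..n}" and ran: "ran s \<subseteq> {1..m}"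
    and i: "i \<in> {1..n}" "i \<notin> dom s"
    and big: "\<And>k. k \<in> dom s - dom s2 \<Longrightarrow> p i \<le> p k"
    and full: "\<And>j. j \<in> {1..m} \<Longrightarrow> c * lower_bound m p n < load p s j + p i"
  shows False
proof -
  let ?L = "lower_bound m p n"
  let ?a = "real (card (machines_A m))"
  let ?b = "real (card (machines_B m))"
  have fin: "finite (dom s)" by (rule finite_subset[OF dom]) simp
  have pi: "0 < p i" by (rule pos[OF i(1)])
  have piL: "p i \<le> ?L" using job_le_lower_bound[of i n p m] i(1) pi by simp
  have "(\<Sum>k \<in> insert i (dom s). p k) \<le> psum p n"
    unfolding psum_def using i dom by (intro sum_mono2) (auto intro!: less_imp_le pos)
  then have total: "p i + (\<Sum>j = 1..m. load p s j) \<le> real m * ?L"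
    using psum_le_lower_bound[of m p n] m fin i(2) sum_load[OF fin ran, of p] by simp
  show False
  proof (cases "p i \<le> ?L / 2")
    case True
    have "?L \<le> load p s j" if "j \<in> {1..m}" for j
    proof -
      \<comment> \<open>Each load exceeds \<open>c * ?L - ?L / 2\<close>, so already
        \<open>c >= 3/2\<close> forces it up to \<open>?L\<close>; the unassigned job
        \<open>i\<close> then makes the total too large.\<close>
      have "(3 / 2) * ?L \<le> c * ?L" using c pi piL by (intro mult_right_mono) auto
      then show ?thesis using full[OF that] True by linarith
    qed
    then have "real (card {1..m}) * ?L \<le> (\<Sum>j = 1..m. load p s j)" by (rule card_mult_le_sum)
    then show False using total pi by simp
  next
    case False
    \<comment> \<open>As \<open>p i <= ?L\<close>, machine \<open>j\<close> now carries more than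
      \<open>(c - 1) * ?L\<close>, so it must have received a reassigned job.\<close>
    have new: "\<exists>k. k \<in> dom s - dom s2 \<and> s k = Some j"
      if "j \<in> {1..m}" "load p s2 j \<le> (c - 1) * ?L" for j
    proof (rule ccontr)
      assume "\<not> ?thesis"
      then have "{k. s k = Some j} = {k. s2 k = Some j}"
        using le by (fastforce simp: map_le_def dom_def)
      then have "load p s j = load p s2 j" by (simp add: load_def)
      then show False using full[OF that(1)] that(2) piL by (simp add: algebra_simps)
    qed
    have Am: "j \<in> {1..m}" if "j \<in> machines_A m" for j using that machines_subset by blast
    have Bm: "j \<in> {1..m}" if "j \<in> machines_B m" for j using that machines_subset by blast
    show False using alt
    proof
      assume B2: "\<forall>j \<in> machines_B m. load p s2 j \<le> (c - 1) * ?L"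
      have "{1..m} = machines_A m \<union> machines_B m" by (auto simp: machines_A_def machines_B_def)
      then have "\<forall>j \<in> {1..m}. \<exists>k. k \<in> dom s - dom s2 \<and> s k = Some j" using new A2 B2 by blast
      \<comment> \<open>\<open>f\<close> selects one reassigned job per machine. It is injective
        because a job lies on only one machine; adding \<open>i\<close> gives \<open>m + 1\<close>
        jobs longer than \<open>?L / 2\<close>.\<close>
      then obtain f where f: "\<forall>j \<in> {1..m}. f j \<in> dom s - dom s2 \<and> s (f j) = Some j" by metis
      have "inj_on f {1..m}" using f by (metis inj_onI option.inject)
      then have "card (f ` {1..m}) = m" by (simp add: card_image)
      moreover have "i \<notin> f ` {1..m}" using f i(2) by auto
      ultimately have "card (insert i (f ` {1..m})) = m + 1" by simp
      moreover have "insert i (f ` {1..m}) \<subseteq> {k \<in> {1..n}. p i \<le> p k}"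
        using i(1) f dom big by blast
      then have "card (insert i (f ` {1..m})) \<le> card {k \<in> {1..n}. p i \<le> p k}"
        by (intro card_mono) auto
      ultimately have "p i \<le> kth_largest p n (m + 1)"
        using le_kth_largest_iff[of "m + 1" "p i" p n] pi by simp
      then show False using lower_bound_ge(3)[of p n m] False by linarith
    next
      assume low: "\<forall>k \<in> machines_A m. (2 - c) * ?L \<le> load p s2 k"
      have "(2 - c) * ?L + p i \<le> load p s j" if j: "j \<in> machines_A m" for j
      proof -
        obtain k where k: "k \<in> dom s - dom s2" "s k = Some j" using new[OF Am[OF j] A2[OF j]] by blast
        have fin2: "finite (dom s2)"
          by (rule finite_subset[OF _ fin]) (use le in \<open>auto simp: map_le_def dom_def\<close>)
        \<comment> \<open>The intermediate schedule \<open>s2(k \<mapsto> j)\<close> lies between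
          \<open>s2\<close> and \<open>s\<close> and isolates the contribution of one reassigned
          job.\<close>
        have "load p (s2(k \<mapsto> j)) j = load p s2 j + p k" using load_upd[OF fin2, of k] k by simp
        moreover have "load p (s2(k \<mapsto> j)) j \<le> load p s j"
          by (rule load_mono[OF fin]) (use le k pos dom in \<open>auto simp: map_le_def\<close>)
        ultimately show ?thesis using low j big[OF k(1)] by fastforce
      qed
      then have "?a * ((2 - c) * ?L + p i) \<le> (\<Sum>j \<in> machines_A m. load p s j)"
        by (rule card_mult_le_sum)
      moreover have "?b * (c * ?L - p i) \<le> (\<Sum>j \<in> machines_B m. load p s j)"
        using full Bm by (intro card_mult_le_sum) (auto simp: algebra_simps intro!: less_imp_le)
      ultimately have *: "p i + ?a * ((2 - c) * ?L + p i) + ?b * (c * ?L - p i) \<le> real m * ?L"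
        using total unfolding sum_machines by linarith
      \<comment> \<open>Pairing machines of \<open>A\<close> and \<open>B\<close> cancels
        \<open>c\<close> and \<open>p i\<close>. For even \<open>m\<close> the unassigned job
        remains in excess; for odd \<open>m\<close> it combines with the extra machine of
        \<open>B\<close> to give \<open>c * ?L\<close>, against the single \<open>?L\<close>
        available.\<close>
      have "real m = 2 * ?a \<or> real m = 2 * ?a + 1" by (rule card_machines(2))
      then show False
      proof
        assume e: "real m = 2 * ?a"
        have "p i \<le> 0" using * unfolding card_machines(1) e by (simp add: algebra_simps)
        then show False using pi by simp
      next
        assume e: "real m = 2 * ?a + 1"
        have "c * ?L \<le> 1 * ?L" using * unfolding card_machines(1) e by (simp add: algebra_simps)
        then have "c \<le> 1" using pi piL by (simp only: mult_le_cancel_right)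
        then show False using c by simp
      qed
    qed
  qed
qed

text \<open>Induction with \<open>s2\<close> fixed. The invariant is that \<open>s\<close> extends
  \<open>s2\<close>, that jobs reassigned so far are at least as long as those waiting, and that all
  loads are at most \<open>c * L\<close>. Assignments to \<open>B\<close> preserve the bound by
  their own test.\<close>

lemma reassignment_load:
  assumes "reassignment c m p (lower_bound m p n) is s s'"
    and c: "5 / 3 \<le> c" and m: "2 \<le> m"
    and pos: "\<And>i. i \<in> {1..n} \<Longrightarrow> 0 < p i"
    and A2: "\<And>j. j \<in> machines_A m \<Longrightarrow> load p s2 j \<le> (c - 1) * lower_bound m p n"
    and alt: "(\<forall>j \<in> machines_B m. load p s2 j \<le> (c - 1) * lower_bound m p n) \<or>
      (\<forall>k \<in> machines_A m. (2 - c) * lower_bound m p n \<le> load p s2 k)"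
    and "s2 \<subseteq>\<^sub>m s" "dom s \<subseteq> {1..n}" "ran s \<subseteq> {1..m}"
    and "set is \<subseteq> {1..n} - dom s" "distinct is" "sorted_wrt (\<lambda>i k. p i \<ge> p k) is"
    and "\<And>k i. k \<in> dom s - dom s2 \<Longrightarrow> i \<in> set is \<Longrightarrow> p i \<le> p k"
    and "\<And>j. j \<in> {1..m} \<Longrightarrow> load p s j \<le> c * lower_bound m p n"
    and "j \<in> {1..m}"
  shows "load p s' j \<le> c * lower_bound m p n"
  using assms(1,7-)
proof (induction arbitrary: j rule: reassignment.induct)
  case (finished s)
  then show ?case by blast
next
  case (to_B j' s i "is" s')
  have fin: "finite (dom s)" by (rule finite_subset[OF to_B.prems(2)]) simp
  have i: "i \<in> {1..n}" "i \<notin> dom s" using to_B.prems(4) by auto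
  show ?case
  proof (rule to_B.IH)
    show "s2 \<subseteq>\<^sub>m s(i \<mapsto> j')" using to_B.prems(1) i(2) by (auto simp: map_le_def dom_def)
    show "ran (s(i \<mapsto> j')) \<subseteq> {1..m}"
      using to_B.prems(3) to_B(1) machines_subset[of m] by (auto simp: ran_def)
    show "load p (s(i \<mapsto> j')) k \<le> c * lower_bound m p n" if "k \<in> {1..m}" for k
      using to_B.prems(8)[OF that] to_B(2) load_upd[OF fin i(2)] by simp
    show "p x \<le> p k" if "k \<in> dom (s(i \<mapsto> j')) - dom s2" "x \<in> set is" for k x
      using that to_B.prems(6,7) by (auto split: if_splits)
    show "dom (s(i \<mapsto> j')) \<subseteq> {1..n}" using to_B.prems(2) i(1) by simp
    show "set is \<subseteq> {1..n} - dom (s(i \<mapsto> j'))" using to_B.prems(4,5) by auto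
    show "distinct is" "sorted_wrt (\<lambda>i k. p i \<ge> p k) is" using to_B.prems(5,6) by simp_all
  qed (rule to_B.prems(9))
next
  case (to_A s i j' "is" s')
  have fin: "finite (dom s)" by (rule finite_subset[OF to_A.prems(2)]) simp
  have i: "i \<in> {1..n}" "i \<notin> dom s" using to_A.prems(4) by auto
  have j': "j' \<in> machines_A m" using to_A(2) by (simp add: is_arg_min_def)
  have step: "load p s j' + p i \<le> c * lower_bound m p n"
  proof (rule ccontr)
    assume not: "\<not> ?thesis"
    \<comment> \<open>If the least loaded machine of \<open>A\<close> overflows, so does every
      machine of \<open>A\<close>; on \<open>B\<close> the failed test says the same.\<close>
    have "c * lower_bound m p n < load p s k + p i" if k: "k \<in> {1..m}" for k
    proof (cases "k \<in> machines_A m")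
      case True
      then have "load p s j' \<le> load p s k" using to_A(2) by (force simp: is_arg_min_def)
      then show ?thesis using not by linarith
    next
      case False
      then have "k \<in> machines_B m" using k by (auto simp: machines_A_def machines_B_def)
      then show ?thesis using to_A(1) by force
    qed
    moreover have "p i \<le> p k" if "k \<in> dom s - dom s2" for k using to_A.prems(7)[OF that] by simp
    ultimately show False
      using reassignment_step[OF c m pos A2 alt to_A.prems(1-3) i] by blast
  qed
  show ?case
  proof (rule to_A.IH)
    show "s2 \<subseteq>\<^sub>m s(i \<mapsto> j')" using to_A.prems(1) i(2) by (auto simp: map_le_def dom_def)
    show "ran (s(i \<mapsto> j')) \<subseteq> {1..m}"
      using to_A.prems(3) j' machines_subset[of m] by (auto simp: ran_def)
    show "load p (s(i \<mapsto> j')) k \<le> c * lower_bound m p n" if "k \<in> {1..m}" for k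
      using to_A.prems(8)[OF that] step load_upd[OF fin i(2)] by simp
    show "p x \<le> p k" if "k \<in> dom (s(i \<mapsto> j')) - dom s2" "x \<in> set is" for k x
      using that to_A.prems(6,7) by (auto split: if_splits)
    show "dom (s(i \<mapsto> j')) \<subseteq> {1..n}" using to_A.prems(2) i(1) by simp
    show "set is \<subseteq> {1..n} - dom (s(i \<mapsto> j'))" using to_A.prems(4,5) by auto
    show "distinct is" "sorted_wrt (\<lambda>i k. p i \<ge> p k) is" using to_A.prems(5,6) by simp_all
  qed (rule to_A.prems(9))
qed

section \<open>From the load bounds of the phases to the competitive ratio\<close>

theorem theorem3:
  fixes c :: real and m n :: nat and p :: "nat \<Rightarrow> real" and s :: schedule
  assumes "5 / 3 \<le> c" and "c \<le> 2" and "2 \<le> m"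
    and "\<And>i. i \<in> {1..n} \<Longrightarrow> 0 < p i"
    and "ALG c m p n s"
  shows "makespan m p s \<le> c * opt m p n"
proof -
  let ?L = "lower_bound m p n"
  note c = assms(1,2) and m = assms(3) and pos = assms(4)
  obtain s0 s1 R1 s2 R2 "is" where s0: "arrival_phase c m p n s0" and s1: "removal_B m p s0 s1 R1"
    and s2: "removal_A c m p ?L s1 R1 s2 R2"
    and "is": "distinct is" "set is = R2" "sorted_wrt (\<lambda>i k. p i \<ge> p k) is"
    and s: "reassignment c m p ?L is s2 s"
    using assms(5) unfolding ALG_def by blast
  have dom0: "dom s0 = {1..n}" and ran0: "ran s0 \<subseteq> {1..m}"
    using arrival_phase_schedules[OF s0] by (simp_all add: schedules_def)
  have fin1: "finite (dom s1)" using removal_B_jobs(1)[OF s1] dom0 by (metis finite_Un finite_atLeastAtMost)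
  have "dom s1 \<inter> R1 = {}" using s1 by (auto simp: removal_B_def)
  then have disj: "dom s2 \<inter> R2 = {}" using removal_A_props[OF s2 fin1] by blast
  have dom2: "dom s2 \<union> R2 = {1..n}" and ran2: "ran s2 \<subseteq> {1..m}"
    using removal_A_jobs[OF s2] removal_B_jobs[OF s1] dom0 ran0 by auto
  have A2: "load p s2 j \<le> (c - 1) * ?L" if "j \<in> machines_A m" for j
    using removal_A_props[OF s2 fin1] that by blast
  have L: "0 \<le> ?L" by (rule lower_bound_nonneg) (rule pos)
  have start: "load p s2 j \<le> c * ?L" if "j \<in> {1..m}" for j
  proof (cases "j \<in> machines_A m")
    case True
    then show ?thesis using A2[OF True] L by (simp add: algebra_simps)
  next
    case False
    then have j: "j \<in> machines_B m" using that by (auto simp: machines_A_def machines_B_def)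
    then have "load p s2 j = load p s1 j" using removal_A_props[OF s2 fin1] by blast
    then show ?thesis using load_after_removal_B[OF s0 s1 c m pos j] by simp
  qed
  have "load p s j \<le> c * ?L" if "j \<in> {1..m}" for j
  proof (rule reassignment_load[OF s c(1) m pos A2 load_after_removal[OF s0 s1 s2 c m pos]])
    show "set is \<subseteq> {1..n} - dom s2" using "is"(2) disj dom2 by blast
    show "dom s2 \<subseteq> {1..n}" using dom2 by blast
  qed (use "is" ran2 start that in auto)
  then have "makespan m p s \<le> c * ?L" unfolding makespan_def using m by (intro Max.boundedI) auto
  \<comment> \<open>The schedule produced by the algorithm itself witnesses that the minimum
    defining \<open>opt\<close> ranges over a nonempty set.\<close>
  also have "\<dots> \<le> c * opt m p n"
    using lower_bound_le_opt[of m n p] pos m c ALG_schedules[OF assms(5)]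
    by (intro mult_left_mono) auto
  finally show ?thesis .
qed

end
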